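(* Let $t>0$ and let $X$ and $\{X^n\}_{n\ge1}$ be real-valued adapted càdlàg processes on $[0,t]$ such that each $X^n-X$ admits quadratic variation and $$[X^n-X]_t\to0\qquad\text{in probability as } n\to\infty.$$ Fix $r>0$, and for each $k\ge1$ define $$\delta(k,r):=\frac{r}{2^{k+2}},\qquad L(r,k):=r\Big(1-\frac{3}{2^{k+2}}\Big),$$ $$A_k(r):=\Big\{\omega:\ \big||\Delta X_s(\omega)|-L(r,k)\big|>\delta(k,r)\ \text{ for all } s\le t\Big\}.$$ Then $$\mathbb P\Big(\bigcup_{k\ge1}A_k(r)\Big)=1.$$ Moreover, for each fixed $k\ge1$, setting $$B_n(k,r):=\Big\{\sup_{s\le t}|\Delta(X^n-X)_s|<\delta(k,r)\Big\},$$ one has $\lim_{n\to\infty}\mathbb P(B_n(k,r))=1$. On the event $A_k(r)\cap B_n(k,r)$ the classification of jumps relative to the threshold $L(r,k)$ is preserved, i.e. for all $s\le t$, $$|\Delta X_s|\le L(r,k)-\delta(k,r)\ \Longrightarrow\ |\Delta X^n_s|<L(r,k),$$ $$|\Delta X_s|\ge L(r,k)+\delta(k,r)\ \Longrightarrow\ |\Delta X^n_s|>L(r,k).$$ In particular, on $A_k(r)\cap B_n(k,r)$, $$1_{\{|\Delta X^n_s|\le L(r,k)\}}\le 1_{\{|\Delta X_s|\le L(r,k)\}}\qquad\text{for all } s\le t,$$ and therefore $$\sum_{s\le t}(\Delta X^n_s)^2\,1_{\{|\Delta X^n_s|\le L(r,k)\}}\le 2[X^n-X]_t+2\sum_{s\le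 t}(\Delta X_s)^2\,1_{\{|\Delta X_s|\le L(r,k)\}}.$$
   Context: All processes are defined on a common filtered probability space $(\Omega,\mathcal F,\{\mathcal F_u\}_{u\ge0},\mathbb P)$ satisfying the usual hypotheses and are adapted to this filtration. $\Delta Y_s=Y_s-Y_{s-}$ denotes the jump of a càdlàg process $Y$ at time $s$ (with $\Delta Y_0=0$). Quadratic variation: a càdlàg process $Y$ on $[0,t]$ admits quadratic variation if for every $u\le t$ the sums $\sum_i (Y_{u_i}-Y_{u_{i-1}})^2$ over partitions $0=u_0<\dots<u_N=u$ converge in probability as the mesh tends to $0$; the limit is denoted $[Y]_u$. Inequalities involving quadratic variation are understood up to null sets. *)

theory Defs
  imports "HOL-Probability.Probability"
begin

text \<open>Only times \<open>u \<ge> 0\<close> are constrained; the values of \<open>F\<close> at negative times are irrelevant.\<close>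

locale usual_filtered_prob_space = prob_space M + complete_measure M
  for M :: "'a measure" +
  fixes F :: "real \<Rightarrow> 'a measure"
  assumes subalgebra_F: "0 \<le> u \<Longrightarrow> subalgebra M (F u)"
    and F_mono: "0 \<le> u \<Longrightarrow> u \<le> v \<Longrightarrow> sets (F u) \<subseteq> sets (F v)"
    and F_right_continuous: "0 \<le> u \<Longrightarrow> sets (F u) = (\<Inter>v\<in>{u<..}. sets (F v))"
    and F_null_sets: "null_sets M \<subseteq> sets (F 0)"

definition cadlag_on :: "real \<Rightarrow> (real \<Rightarrow> real) \<Rightarrow> bool" where
  "cadlag_on t f \<longleftrightarrow>
     (\<forall>s\<in>{0..<t}. continuous (at_right s) f) \<and>
     (\<forall>s\<in>{0<..t}. \<exists>l. (f \<longlongrightarrow> l) (at_left s))"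

definition adapted_cadlag ::
  "'a measure \<Rightarrow> (real \<Rightarrow> 'a measure) \<Rightarrow> real \<Rightarrow> (real \<Rightarrow> 'a \<Rightarrow> real) \<Rightarrow> bool" where
  "adapted_cadlag M F t X \<longleftrightarrow>
     (\<forall>u\<in>{0..t}. X u \<in> borel_measurable (F u)) \<and>
     (\<forall>\<omega>\<in>space M. cadlag_on t (\<lambda>s. X s \<omega>))"

text \<open>The jump of a path at time \<open>s \<ge> 0\<close>; it is only meaningful where the left limit exists.\<close>

definition jump :: "(real \<Rightarrow> real) \<Rightarrow> real \<Rightarrow> real" where
  "jump f s = (if s = 0 then 0 else f s - Lim (at_left s) f)"

definition tendsto_in_prob ::
  "'a measure \<Rightarrow> ('i \<Rightarrow> 'a \<Rightarrow> real) \<Rightarrow> ('a \<Rightarrow> real) \<Rightarrow> 'i filter \<Rightarrow> bool" where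
  "tendsto_in_prob M Y Z G \<longleftrightarrow>
     (\<forall>\<epsilon>>0. ((\<lambda>i. measure M {\<omega>\<in>space M. \<bar>Y i \<omega> - Z \<omega>\<bar> > \<epsilon>}) \<longlongrightarrow> 0) G)"

text \<open>A partition \<open>0 = u\<^sub>0 < \<dots> < u\<^sub>N = u\<close> is the list \<open>[u\<^sub>0, \<dots>, u\<^sub>N]\<close>; for \<open>u = 0\<close> this is \<open>[0]\<close>.\<close>

definition partitions :: "real \<Rightarrow> real list set" where
  "partitions u = {p. p \<noteq> [] \<and> hd p = 0 \<and> last p = u \<and> sorted_wrt (<) p}"

definition mesh_to_0 :: "real \<Rightarrow> real list filter" where
  "mesh_to_0 u =
     (INF h\<in>{0<..}. principal {p \<in> partitions u. \<forall>i. Suc i < length p \<longrightarrow> p ! Suc i - p ! i < h})"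

definition sum_sq_incr :: "(real \<Rightarrow> real) \<Rightarrow> real list \<Rightarrow> real" where
  "sum_sq_incr f p = (\<Sum>i<length p - 1. (f (p ! Suc i) - f (p ! i))\<^sup>2)"

text \<open>Quadratic variation is determined only up to null sets, so it is treated as a relation:
  \<open>Y\<close> admits quadratic variation on \<open>[0,t]\<close>, and \<open>Q\<close> is a version of \<open>u \<mapsto> [Y]\<^sub>u\<close>.\<close>

definition has_quadratic_variation ::
  "'a measure \<Rightarrow> real \<Rightarrow> (real \<Rightarrow> 'a \<Rightarrow> real) \<Rightarrow> (real \<Rightarrow> 'a \<Rightarrow> real) \<Rightarrow> bool" where
  "has_quadratic_variation M t Y Q \<longleftrightarrow>
     (\<forall>u\<in>{0..t}. Q u \<in> borel_measurable M \<and>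
        tendsto_in_prob M (\<lambda>p \<omega>. sum_sq_incr (\<lambda>s. Y s \<omega>) p) (Q u) (mesh_to_0 u))"

definition jump_radius :: "nat \<Rightarrow> real \<Rightarrow> real" where
  "jump_radius k r = r / 2 ^ (k + 2)"

definition jump_level :: "real \<Rightarrow> nat \<Rightarrow> real" where
  "jump_level r k = r * (1 - 3 / 2 ^ (k + 2))"

definition event_A ::
  "'a measure \<Rightarrow> real \<Rightarrow> (real \<Rightarrow> 'a \<Rightarrow> real) \<Rightarrow> nat \<Rightarrow> real \<Rightarrow> 'a set" where
  "event_A M t X k r =
     {\<omega>\<in>space M. \<forall>s\<in>{0..t}.
        \<bar>\<bar>jump (\<lambda>u. X u \<omega>) s\<bar> - jump_level r k\<bar> > jump_radius k r}"

text \<open>A path that is cadlag on \<open>[0,t]\<close> is bounded there, so for such \<open>Y\<close> the supremum below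
  is over a nonempty bounded set of reals.\<close>

definition event_B ::
  "'a measure \<Rightarrow> real \<Rightarrow> (real \<Rightarrow> 'a \<Rightarrow> real) \<Rightarrow> nat \<Rightarrow> real \<Rightarrow> 'a set" where
  "event_B M t Y k r =
     {\<omega>\<in>space M. (SUP s\<in>{0..t}. \<bar>jump (\<lambda>u. Y u \<omega>) s\<bar>) < jump_radius k r}"

text \<open>The sum \<open>\<Sum>\<^sub>s\<^sub>\<le>\<^sub>t (\<Delta>f\<^sub>s)\<^sup>2 1(\<bar>\<Delta>f\<^sub>s\<bar> \<le> c)\<close> may be infinite,
  hence it is taken in \<open>ennreal\<close>.\<close>

definition small_jump_sum :: "real \<Rightarrow> real \<Rightarrow> (real \<Rightarrow> real) \<Rightarrow> ennreal" where
  "small_jump_sum t c f =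
     (\<Sum>\<^sub>\<infinity>s\<in>{0..t}. ennreal ((jump f s)\<^sup>2 * of_bool (\<bar>jump f s\<bar> \<le> c)))"

end

theory Submission
  imports Defs
begin

text \<open>The bands \<open>[L(r,k) - \<delta>(k,r), L(r,k) + \<delta>(k,r)]\<close> are the intervals
  \<open>[r (1 - 2\<^sup>-\<^sup>k), r (1 - 2\<^sup>-\<^sup>k\<^sup>-\<^sup>1)]\<close>. For \<open>k \<ge> 1\<close> they lie in \<open>[r / 2, r)\<close>, and
  those of odd index are pairwise disjoint. A cadlag path has only finitely many jumps of size at least \<open>r / 2\<close>
  (\<open>finite_large_jumps\<close>), so it cannot have a jump size in every band
  (\<open>cadlag_on_avoids_some_band\<close>): every \<open>\<omega>\<close> lies in some \<open>A k\<close>.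

  Write \<open>Y = X\<^sup>n - X\<close>. The link to quadratic variation is that \<open>\<Sum>\<^sub>s\<^sub>\<in>\<^sub>J (\<Delta>Y\<^sub>s)\<^sup>2 \<le> [Y]\<^sub>t\<close> almost surely,
  simultaneously for all finite \<open>J\<close> (\<open>AE_sum_jump_sq_le_quadratic_variation\<close>): along partitions of
  vanishing mesh, the increments over the partition intervals that contain the times in \<open>J\<close> converge to
  the jumps. With \<open>J\<close> a single time, a jump of \<open>Y\<close> of size at least \<open>\<delta>\<close> forces \<open>[Y]\<^sub>t \<ge> \<delta>\<^sup>2\<close>, whose
  probability tends to \<open>0\<close>; hence \<open>P(B n k) \<longlonglongrightarrow> 1\<close>.

  On \<open>A k \<inter> B n k\<close> the jumps of \<open>X\<close> stay further than \<open>\<delta>\<close> away from the threshold and \<open>\<Delta>X\<^sup>n\<close> differs from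
  \<open>\<Delta>X\<close> by less than \<open>\<delta>\<close>, so both lie on the same side. The final estimate is
  \<open>(a + b)\<^sup>2 \<le> 2 a\<^sup>2 + 2 b\<^sup>2\<close> summed over the small jumps (\<open>small_jump_sum_le\<close>).

  The events \<open>A k\<close> and \<open>B n k\<close> range over uncountably many times; they are measurable because the presence of a
  jump in a closed set that avoids \<open>0\<close> can be read off from countably many increments
  (\<open>ex_jump_in_closed_iff\<close>).\<close>

section \<open>Jumps of a single path\<close>

lemma cadlag_on_left_limit:
  assumes "cadlag_on t f" "0 < s" "s \<le> t"
  shows "(f \<longlongrightarrow> f s - jump f s) (at_left s)"
proof -
  from assms obtain l where l: "(f \<longlongrightarrow> l) (at_left s)"
    unfolding cadlag_on_def by (meson greaterThanAtMost_iff)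
  hence "Lim (at_left s) f = l"
    by (intro tendsto_Lim) auto
  thus ?thesis using l assms by (simp add: jump_def)
qed

lemma jump_zero_time [simp]: "jump f 0 = 0"
  by (simp add: jump_def)

lemma jump_diff:
  assumes "cadlag_on t f" "cadlag_on t g" "s \<in> {0..t}"
  shows "jump (\<lambda>u. f u - g u) s = jump f s - jump g s"
proof (cases "s = 0")
  case False
  hence s: "0 < s" "s \<le> t" using assms by auto
  have "((\<lambda>u. f u - g u) \<longlongrightarrow> (f s - jump f s) - (g s - jump g s)) (at_left s)"
    using s assms by (intro tendsto_diff cadlag_on_left_limit) auto
  hence "Lim (at_left s) (\<lambda>u. f u - g u) = (f s - jump f s) - (g s - jump g s)"
    by (intro tendsto_Lim) auto
  thus ?thesis using False by (simp add: jump_def[of "\<lambda>u. f u - g u"])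
qed simp

lemma cadlag_on_diff:
  assumes "cadlag_on t f" "cadlag_on t g"
  shows "cadlag_on t (\<lambda>u. f u - g u)"
  unfolding cadlag_on_def
proof (intro conjI ballI)
  fix s assume "s \<in> {0..<t}"
  thus "continuous (at_right s) (\<lambda>u. f u - g u)"
    using assms unfolding cadlag_on_def by (intro continuous_diff) auto
next
  fix s assume "s \<in> {0<..t}"
  then obtain l l' where "(f \<longlongrightarrow> l) (at_left s)" "(g \<longlongrightarrow> l') (at_left s)"
    using assms unfolding cadlag_on_def by meson
  thus "\<exists>l. ((\<lambda>u. f u - g u) \<longlongrightarrow> l) (at_left s)"
    by (intro exI[of _ "l - l'"] tendsto_diff)
qed

text \<open>Left of \<open>s\<close> the path is close to the left limit, from \<open>s\<close> on it is close to \<open>f s\<close>. So an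
  increment over a short interval near \<open>s\<close> is close to the jump at \<open>s\<close> when the interval
  straddles \<open>s\<close>, and close to \<open>0\<close> otherwise. Everything below about paths comes from this.\<close>

lemma cadlag_on_increment_near:
  assumes "cadlag_on t f" "s \<in> {0..t}" "\<epsilon> > 0"
  obtains \<eta> where "\<eta> > 0"
    "\<And>p q. p \<in> {0..t} \<Longrightarrow> q \<in> {0..t} \<Longrightarrow> \<bar>p - s\<bar> < \<eta> \<Longrightarrow> \<bar>q - s\<bar> < \<eta> \<Longrightarrow> p < q \<Longrightarrow>
       \<bar>f q - f p - (if p < s \<and> s \<le> q then jump f s else 0)\<bar> < \<epsilon>"
proof -
  define l where "l = f s - jump f s"
  have "\<exists>\<eta>>0. \<forall>p. 0 \<le> p \<and> s - \<eta> < p \<and> p < s \<longrightarrow> \<bar>f p - l\<bar> < \<epsilon> / 2"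
  proof (cases "s = 0")
    case True
    thus ?thesis by (intro exI[of _ 1]) auto
  next
    case False
    have "(f \<longlongrightarrow> l) (at_left s)"
      using False assms unfolding l_def by (intro cadlag_on_left_limit) auto
    hence "eventually (\<lambda>p. dist (f p) l < \<epsilon> / 2) (at_left s)"
      using assms by (intro tendstoD) auto
    then obtain b where "b < s" "\<And>p. b < p \<Longrightarrow> p < s \<Longrightarrow> dist (f p) l < \<epsilon> / 2"
      by (auto simp: eventually_at_left_field)
    thus ?thesis by (intro exI[of _ "s - b"]) (auto simp: dist_real_def)
  qed
  then obtain \<eta>1 where \<eta>1: "\<eta>1 > 0"
    "\<And>p. 0 \<le> p \<Longrightarrow> s - \<eta>1 < p \<Longrightarrow> p < s \<Longrightarrow> \<bar>f p - l\<bar> < \<epsilon> / 2" by blast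
  have "\<exists>\<eta>>0. \<forall>q. q \<le> t \<and> s \<le> q \<and> q < s + \<eta> \<longrightarrow> \<bar>f q - f s\<bar> < \<epsilon> / 2"
  proof (cases "s = t")
    case True
    thus ?thesis using assms by (intro exI[of _ 1]) auto
  next
    case False
    have "(f \<longlongrightarrow> f s) (at_right s)"
      using False assms unfolding cadlag_on_def by (auto simp: continuous_within)
    hence "eventually (\<lambda>p. dist (f p) (f s) < \<epsilon> / 2) (at_right s)"
      using assms by (intro tendstoD) auto
    then obtain b where b: "b > s" "\<And>p. s < p \<Longrightarrow> p < b \<Longrightarrow> dist (f p) (f s) < \<epsilon> / 2"
      by (auto simp: eventually_at_right_field)
    have "\<bar>f q - f s\<bar> < \<epsilon> / 2" if "s \<le> q" "q < b" for q
      using b(2)[of q] that assms by (cases "q = s") (auto simp: dist_real_def)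
    thus ?thesis using b by (intro exI[of _ "b - s"]) auto
  qed
  then obtain \<eta>2 where \<eta>2: "\<eta>2 > 0"
    "\<And>q. q \<le> t \<Longrightarrow> s \<le> q \<Longrightarrow> q < s + \<eta>2 \<Longrightarrow> \<bar>f q - f s\<bar> < \<epsilon> / 2" by blast
  show ?thesis
  proof (rule that[of "min \<eta>1 \<eta>2"])
    show "min \<eta>1 \<eta>2 > 0" using \<eta>1 \<eta>2 by simp
  next
    fix p q assume pq: "p \<in> {0..t}" "q \<in> {0..t}" "\<bar>p - s\<bar> < min \<eta>1 \<eta>2" "\<bar>q - s\<bar> < min \<eta>1 \<eta>2" "p < q"
    have L: "\<bar>f u - l\<bar> < \<epsilon> / 2" if "u \<in> {p, q}" "u < s" for u
      using that pq by (intro \<eta>1) auto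
    have R: "\<bar>f u - f s\<bar> < \<epsilon> / 2" if "u \<in> {p, q}" "s \<le> u" for u
      using that pq by (intro \<eta>2) auto
    consider "p < s" "s \<le> q" | "p < s" "q < s" | "s \<le> p" "s \<le> q" using pq by linarith
    thus "\<bar>f q - f p - (if p < s \<and> s \<le> q then jump f s else 0)\<bar> < \<epsilon>"
    proof cases
      case 1
      hence "\<bar>f p - l\<bar> < \<epsilon> / 2" "\<bar>f q - f s\<bar> < \<epsilon> / 2" using L R by auto
      hence "\<bar>f q - f p - (f s - l)\<bar> < \<epsilon>" by arith
      thus ?thesis using 1 by (simp add: l_def)
    next
      case 2
      hence "\<bar>f p - l\<bar> < \<epsilon> / 2" "\<bar>f q - l\<bar> < \<epsilon> / 2" using L by auto
      hence "\<bar>f q - f p\<bar> < \<epsilon>" by arith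
      thus ?thesis using 2 by simp
    next
      case 3
      hence "\<bar>f p - f s\<bar> < \<epsilon> / 2" "\<bar>f q - f s\<bar> < \<epsilon> / 2" using R by auto
      hence "\<bar>f q - f p\<bar> < \<epsilon>" by arith
      thus ?thesis using 3 by simp
    qed
  qed
qed

lemma cadlag_on_increment_tendsto_jump:
  assumes "cadlag_on t f" "s \<in> {0<..t}" "p \<longlonglongrightarrow> s" "q \<longlonglongrightarrow> s"
    and "\<And>m. p m \<in> {0..<s}" "\<And>m. q m \<in> {s..t}"
  shows "(\<lambda>m. f (q m) - f (p m)) \<longlonglongrightarrow> jump f s"
proof (rule tendstoI)
  fix \<epsilon> :: real assume "\<epsilon> > 0"
  with assms obtain \<eta> where \<eta>: "\<eta> > 0"
    "\<And>p q. p \<in> {0..t} \<Longrightarrow> q \<in> {0..t} \<Longrightarrow> \<bar>p - s\<bar> < \<eta> \<Longrightarrow> \<bar>q - s\<bar> < \<eta> \<Longrightarrow> p < q \<Longrightarrow>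
       \<bar>f q - f p - (if p < s \<and> s \<le> q then jump f s else 0)\<bar> < \<epsilon>"
    using cadlag_on_increment_near[of t f s \<epsilon>] by (metis atLeastAtMost_iff greaterThanAtMost_iff less_imp_le)
  have "eventually (\<lambda>m. \<bar>p m - s\<bar> < \<eta>) sequentially" "eventually (\<lambda>m. \<bar>q m - s\<bar> < \<eta>) sequentially"
    using tendstoD[OF assms(3) \<eta>(1)] tendstoD[OF assms(4) \<eta>(1)] by (simp_all add: dist_real_def)
  thus "eventually (\<lambda>m. dist (f (q m) - f (p m)) (jump f s) < \<epsilon>) sequentially"
  proof eventually_elim
    case (elim m)
    show ?case using \<eta>(2)[of "p m" "q m"] elim assms(5)[of m] assms(6)[of m] assms(2)
      by (auto simp: dist_real_def)
  qed
qed

text \<open>Infinitely many large jumps would accumulate at some time \<open>s\<close> of the compact interval, but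
  no interval near \<open>s\<close> that avoids \<open>s\<close> carries a large increment.\<close>

lemma finite_large_jumps:
  assumes "cadlag_on t f" "\<epsilon> > 0"
  shows "finite {s \<in> {0..t}. \<epsilon> \<le> \<bar>jump f s\<bar>}"
proof (rule ccontr)
  let ?S = "{s \<in> {0..t}. \<epsilon> \<le> \<bar>jump f s\<bar>}"
  assume "infinite ?S"
  hence "\<exists>s\<in>{0..t}. s islimpt ?S"
    by (intro Heine_Borel_imp_Bolzano_Weierstrass) auto
  then obtain s where s: "s \<in> {0..t}" "s islimpt ?S" by blast
  obtain \<eta> where \<eta>: "\<eta> > 0"
    "\<And>p q. p \<in> {0..t} \<Longrightarrow> q \<in> {0..t} \<Longrightarrow> \<bar>p - s\<bar> < \<eta> \<Longrightarrow> \<bar>q - s\<bar> < \<eta> \<Longrightarrow> p < q \<Longrightarrow>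
       \<bar>f q - f p - (if p < s \<and> s \<le> q then jump f s else 0)\<bar> < \<epsilon> / 2"
    using cadlag_on_increment_near[of t f s "\<epsilon> / 2"] assms s by auto
  obtain v where v: "v \<in> ?S" "v \<noteq> s" "\<bar>v - s\<bar> < \<eta>"
    using s(2) \<eta>(1) unfolding islimpt_approachable by (auto simp: dist_real_def)
  have "v \<noteq> 0" using v assms by auto
  hence v0: "0 < v" "v \<le> t" using v by auto
  have lim: "((\<lambda>p. \<bar>f v - f p\<bar>) \<longlongrightarrow> \<bar>f v - (f v - jump f v)\<bar>) (at_left v)"
    using v0 assms by (intro tendsto_intros cadlag_on_left_limit) auto
  \<comment> \<open>Intervals \<open>(p, v]\<close> with \<open>p > b\<close> stay within \<open>\<eta>\<close> of \<open>s\<close> and do not straddle it.\<close>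
  define b where "b = max (max 0 (s - \<eta>)) (if s < v then s else 0)"
  have "b < v" using v v0 by (auto simp: b_def)
  hence "eventually (\<lambda>p. b < p \<and> p < v) (at_left v)"
    by (auto simp: eventually_at_left_field)
  hence "eventually (\<lambda>p. \<bar>f v - f p\<bar> \<le> \<epsilon> / 2) (at_left v)"
  proof eventually_elim
    case (elim p)
    have "\<bar>f v - f p - (if p < s \<and> s \<le> v then jump f s else 0)\<bar> < \<epsilon> / 2"
      using elim v v0 by (intro \<eta>(2)) (auto simp: b_def split: if_splits)
    moreover have "\<not> (p < s \<and> s \<le> v)" using elim v by (auto simp: b_def split: if_splits)
    ultimately show ?case by auto
  qed
  hence "\<bar>f v - (f v - jump f v)\<bar> \<le> \<epsilon> / 2"
    by (intro tendsto_upperbound[OF lim]) auto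
  thus False using v assms by auto
qed

text \<open>Strictness survives the supremum because only finitely many jumps have size at least \<open>\<epsilon> / 2\<close>.\<close>

lemma Sup_jump_less_iff:
  assumes "cadlag_on t f" "0 \<le> t" "\<epsilon> > 0"
  shows "(SUP s\<in>{0..t}. \<bar>jump f s\<bar>) < \<epsilon> \<longleftrightarrow> (\<forall>s\<in>{0..t}. \<bar>jump f s\<bar> < \<epsilon>)"
proof -
  define S where "S = {s \<in> {0..t}. \<epsilon> / 2 \<le> \<bar>jump f s\<bar>}"
  define b where "b = Max (insert (\<epsilon> / 2) ((\<lambda>s. \<bar>jump f s\<bar>) ` S))"
  have fin: "finite S" unfolding S_def using assms by (intro finite_large_jumps) auto
  have b: "\<bar>jump f s\<bar> \<le> b" if "s \<in> {0..t}" for s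
  proof (cases "s \<in> S")
    case True thus ?thesis using fin unfolding b_def by (intro Max_ge) auto
  next
    case False
    hence "\<bar>jump f s\<bar> \<le> \<epsilon> / 2" using that by (auto simp: S_def)
    also have "\<epsilon> / 2 \<le> b" using fin unfolding b_def by (intro Max_ge) auto
    finally show ?thesis .
  qed
  show ?thesis
  proof
    assume less: "(SUP s\<in>{0..t}. \<bar>jump f s\<bar>) < \<epsilon>"
    show "\<forall>s\<in>{0..t}. \<bar>jump f s\<bar> < \<epsilon>"
    proof
      fix s assume "s \<in> {0..t}"
      hence "\<bar>jump f s\<bar> \<le> (SUP s\<in>{0..t}. \<bar>jump f s\<bar>)"
        using b by (intro cSUP_upper) (auto intro!: bdd_aboveI[of _ b])
      thus "\<bar>jump f s\<bar> < \<epsilon>" using less by simp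
    qed
  next
    assume less: "\<forall>s\<in>{0..t}. \<bar>jump f s\<bar> < \<epsilon>"
    have "(SUP s\<in>{0..t}. \<bar>jump f s\<bar>) \<le> b"
      using assms b by (intro cSUP_least) auto
    also have "b < \<epsilon>"
      using fin less assms by (auto simp: b_def S_def)
    finally show "(SUP s\<in>{0..t}. \<bar>jump f s\<bar>) < \<epsilon>" .
  qed
qed

section \<open>Measurability of jump events\<close>

text \<open>The right-hand side uses countably many increments only, which is what makes the event on the
  left measurable without a projection theorem. Ever shorter intervals whose increments approach
  \<open>C\<close> accumulate at some time \<open>s\<close>, where increments can only approach \<open>0\<close> or the jump at \<open>s\<close>;
  since \<open>0 \<notin> C\<close>, the jump lies in \<open>C\<close>. The end point \<open>t\<close> is added because a jump at \<open>t\<close> is only seen by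
  intervals that end exactly there.\<close>

lemma ex_jump_in_closed_iff:
  assumes "cadlag_on t f" "closed C" "C \<noteq> {}" "0 \<notin> C"
  defines "D \<equiv> insert t (\<rat> \<inter> {0..t})"
  shows "(\<exists>s\<in>{0..t}. jump f s \<in> C) \<longleftrightarrow>
    0 \<le> t \<and> (\<forall>n. \<exists>p\<in>D. \<exists>q\<in>D. p < q \<and> q - p < inverse (real (Suc n)) \<and> infdist (f q - f p) C < inverse (real (Suc n)))"
    (is "?lhs \<longleftrightarrow> 0 \<le> t \<and> (\<forall>n. ?P n)")
proof (intro iffI conjI allI)
  assume ?lhs
  then obtain s where s: "s \<in> {0..t}" "jump f s \<in> C" by auto
  have "s \<noteq> 0" using s assms(4) by auto
  hence s0: "0 < s" "s \<le> t" using s by auto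
  show "0 \<le> t" using s0 by simp
  fix n
  define e where "e = inverse (real (Suc n))"
  have "e > 0" by (simp add: e_def)
  obtain \<eta> where \<eta>: "\<eta> > 0"
    "\<And>p q. p \<in> {0..t} \<Longrightarrow> q \<in> {0..t} \<Longrightarrow> \<bar>p - s\<bar> < \<eta> \<Longrightarrow> \<bar>q - s\<bar> < \<eta> \<Longrightarrow> p < q \<Longrightarrow>
       \<bar>f q - f p - (if p < s \<and> s \<le> q then jump f s else 0)\<bar> < e"
    using cadlag_on_increment_near[of t f s e] assms s \<open>e > 0\<close> by auto
  define \<eta>' where "\<eta>' = min \<eta> (e / 2)"
  have "\<eta>' > 0" using \<eta> \<open>e > 0\<close> by (simp add: \<eta>'_def)
  obtain p where p: "p \<in> \<rat>" "max 0 (s - \<eta>') < p" "p < s"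
    using Rats_dense_in_real[of "max 0 (s - \<eta>')" s] s0 \<open>\<eta>' > 0\<close> by auto
  have "\<exists>q\<in>D. s \<le> q \<and> q < s + \<eta>'"
  proof (cases "s = t")
    case True thus ?thesis using \<open>\<eta>' > 0\<close> by (auto simp: D_def)
  next
    case False
    then obtain q where "q \<in> \<rat>" "s < q" "q < min t (s + \<eta>')"
      using Rats_dense_in_real[of s "min t (s + \<eta>')"] s0 \<open>\<eta>' > 0\<close> by auto
    thus ?thesis using s0 by (intro bexI[of _ q]) (auto simp: D_def)
  qed
  then obtain q where q: "q \<in> D" "s \<le> q" "q < s + \<eta>'" by auto
  have qt: "q \<le> t" using q s0 by (auto simp: D_def)
  have "\<bar>f q - f p - (if p < s \<and> s \<le> q then jump f s else 0)\<bar> < e"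
    using p q qt s0 by (intro \<eta>(2)) (auto simp: \<eta>'_def)
  hence "dist (f q - f p) (jump f s) < e" using p q by (simp add: dist_real_def)
  hence "infdist (f q - f p) C < e" using infdist_le[OF s(2), of "f q - f p"] by simp
  moreover have "q - p < e" using p q by (auto simp: \<eta>'_def min_def split: if_splits)
  moreover have "p \<in> D" using p s0 by (auto simp: D_def)
  ultimately show "?P n" using q(1) p q unfolding e_def by (intro bexI[of _ p] bexI[of _ q]) auto
next
  assume r: "0 \<le> t \<and> (\<forall>n. ?P n)"
  hence D: "D \<subseteq> {0..t}" by (auto simp: D_def)
  from r obtain p q where pq: "\<And>n. p n \<in> D" "\<And>n. q n \<in> D" "\<And>n. p n < q n"
      "\<And>n. q n - p n < inverse (real (Suc n))"
      "\<And>n. infdist (f (q n) - f (p n)) C < inverse (real (Suc n))"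
    by metis
  have "\<forall>n. p n \<in> {0..t}" using pq D by blast
  then obtain s \<sigma> where s: "s \<in> {0..t}" and \<sigma>: "strict_mono (\<sigma> :: nat \<Rightarrow> nat)" "(p \<circ> \<sigma>) \<longlonglongrightarrow> s"
    using compact_Icc[of 0 t] unfolding compact_def by metis
  have inv: "(\<lambda>n. inverse (real (Suc (\<sigma> n)))) \<longlonglongrightarrow> 0"
    using LIMSEQ_subseq_LIMSEQ[OF LIMSEQ_inverse_real_of_nat \<sigma>(1)] by (simp add: o_def)
  show ?lhs
  proof (rule ccontr)
    assume "\<not> ?lhs"
    hence "jump f s \<notin> C" using s by blast
    \<comment> \<open>Both possible limits of the increments keep distance \<open>e\<close> from \<open>C\<close>.\<close>
    define e where "e = min (infdist 0 C) (infdist (jump f s) C)"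
    have "e > 0" using assms \<open>jump f s \<notin> C\<close> by (auto simp: e_def intro!: infdist_pos_not_in_closed)
    obtain \<eta> where \<eta>: "\<eta> > 0"
      "\<And>p q. p \<in> {0..t} \<Longrightarrow> q \<in> {0..t} \<Longrightarrow> \<bar>p - s\<bar> < \<eta> \<Longrightarrow> \<bar>q - s\<bar> < \<eta> \<Longrightarrow> p < q \<Longrightarrow>
         \<bar>f q - f p - (if p < s \<and> s \<le> q then jump f s else 0)\<bar> < e / 2"
      using cadlag_on_increment_near[of t f s "e / 2"] assms s \<open>e > 0\<close> by auto
    have "eventually (\<lambda>n. inverse (real (Suc (\<sigma> n))) < min (e / 2) (\<eta> / 2)) sequentially"
      using \<open>e > 0\<close> \<eta>(1) by (intro order_tendstoD(2)[OF inv]) auto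
    moreover have "eventually (\<lambda>n. dist ((p \<circ> \<sigma>) n) s < \<eta> / 2) sequentially"
      using \<eta>(1) by (intro tendstoD[OF \<sigma>(2)]) auto
    ultimately have "eventually (\<lambda>n. False) sequentially"
    proof eventually_elim
      case (elim n)
      let ?p = "p (\<sigma> n)" and ?q = "q (\<sigma> n)"
      define x where "x = (if ?p < s \<and> s \<le> ?q then jump f s else 0)"
      have "\<bar>?p - s\<bar> < \<eta> / 2" using elim by (simp add: dist_real_def)
      moreover have "\<bar>?q - s\<bar> < \<eta>"
        using calculation pq(3)[of "\<sigma> n"] pq(4)[of "\<sigma> n"] elim by linarith
      moreover have "?p \<in> {0..t}" "?q \<in> {0..t}" using pq(1,2) D by blast+
      ultimately have "\<bar>f ?q - f ?p - x\<bar> < e / 2"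
        unfolding x_def using pq(3) \<eta>(1) by (intro \<eta>(2)) auto
      moreover have "infdist x C \<le> infdist (f ?q - f ?p) C + dist x (f ?q - f ?p)"
        by (rule infdist_triangle)
      moreover have "infdist (f ?q - f ?p) C < e / 2" using pq(5)[of "\<sigma> n"] elim by linarith
      ultimately have "infdist x C < e" by (simp add: dist_real_def abs_minus_commute)
      moreover have "e \<le> infdist x C" by (auto simp: e_def x_def)
      ultimately show ?case by simp
    qed
    thus False by simp
  qed
qed

lemma sets_ex_jump_in_closed:
  assumes meas: "\<And>u. u \<in> {0..t} \<Longrightarrow> Y u \<in> borel_measurable M"
    and cad: "\<And>\<omega>. \<omega> \<in> space M \<Longrightarrow> cadlag_on t (\<lambda>s. Y s \<omega>)"
    and C: "closed C" "0 \<notin> C" and "0 \<le> t"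
  shows "{\<omega> \<in> space M. \<exists>s\<in>{0..t}. jump (\<lambda>u. Y u \<omega>) s \<in> C} \<in> sets M"
proof (cases "C = {}")
  case False
  define D where "D = insert t (\<rat> \<inter> {0..t})"
  have "countable D" by (auto simp: D_def intro: countable_rat countable_subset[of _ \<rat>])
  have Y: "Y u \<in> borel_measurable M" if "u \<in> D" for u
    using that \<open>0 \<le> t\<close> by (intro meas) (auto simp: D_def)
  have inf: "(\<lambda>x. infdist x C) \<in> borel_measurable borel"
    by (intro borel_measurable_continuous_onI continuous_intros)
  have incr: "{\<omega> \<in> space M. infdist (Y q \<omega> - Y p \<omega>) C < c} \<in> sets M" if "p \<in> D" "q \<in> D" for p q c
  proof -
    have "(\<lambda>\<omega>. infdist (Y q \<omega> - Y p \<omega>) C) \<in> borel_measurable M"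
      using that Y by (intro measurable_compose[OF _ inf] borel_measurable_diff)
    thus ?thesis by measurable
  qed
  have "{\<omega> \<in> space M. \<exists>s\<in>{0..t}. jump (\<lambda>u. Y u \<omega>) s \<in> C} =
      {\<omega> \<in> space M. \<forall>n. \<exists>p\<in>D. \<exists>q\<in>D. p < q \<and> q - p < inverse (real (Suc n))
         \<and> infdist (Y q \<omega> - Y p \<omega>) C < inverse (real (Suc n))}"
    using ex_jump_in_closed_iff[OF cad C(1) False C(2)] \<open>0 \<le> t\<close> unfolding D_def by blast
  also have "\<dots> \<in> sets M"
    by (intro sets.sets_Collect_countable_All sets.sets_Collect_countable_Ex' sets.sets_Collect_conj
        sets.sets_Collect_const incr \<open>countable D\<close>)
  finally show ?thesis .
qed simp

section \<open>Jumps and quadratic variation\<close>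

lemma partition_bracket:
  assumes "p \<in> partitions t" "0 < s" "s \<le> t"
  obtains i where "Suc i < length p" "p ! i < s" "s \<le> p ! Suc i"
proof -
  from assms have p: "p \<noteq> []" "p ! 0 = 0" "p ! (length p - 1) = t"
    by (auto simp: partitions_def hd_conv_nth last_conv_nth)
  define j where "j = (LEAST j. s \<le> p ! j)"
  have ex: "s \<le> p ! (length p - 1)" using p assms by simp
  have j: "s \<le> p ! j" unfolding j_def using ex by (rule LeastI)
  have jl: "j \<le> length p - 1" unfolding j_def using ex by (rule Least_le)
  have "j \<noteq> 0" using j p assms by (metis not_le)
  then obtain i where i: "j = Suc i" using not0_implies_Suc by blast
  have "\<not> s \<le> p ! i" using not_less_Least[of i "\<lambda>j. s \<le> p ! j"] i j_def by simp
  moreover have "Suc i < length p" using jl i p by (cases p) auto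
  ultimately show ?thesis using that j i by force
qed

lemma partition_nth_mem:
  assumes "p \<in> partitions t" "i < length p"
  shows "p ! i \<in> {0..t}"
proof -
  from assms have p: "p \<noteq> []" "p ! 0 = 0" "p ! (length p - 1) = t" "sorted_wrt (\<le>) p"
    by (auto simp: partitions_def hd_conv_nth last_conv_nth intro: sorted_wrt_mono_rel[of _ "(<)"])
  have "p ! 0 \<le> p ! i" using p assms by (intro sorted_nth_mono) auto
  moreover have "p ! i \<le> p ! (length p - 1)" using p assms by (intro sorted_nth_mono) auto
  ultimately show ?thesis using p by simp
qed

lemma partition_of_small_mesh:
  assumes "t > 0" "h > 0"
  obtains p where "p \<in> partitions t" "\<And>i. Suc i < length p \<Longrightarrow> p ! Suc i - p ! i < h"
proof -
  obtain N where N: "t / h < real N" using reals_Archimedean2 by blast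
  have "N > 0" using N assms by (cases N) (auto simp: field_simps)
  define p where "p = map (\<lambda>i. t * real i / real N) [0..<Suc N]"
  have "sorted_wrt (<) p"
    using assms \<open>N > 0\<close> unfolding p_def sorted_wrt_map
    by (intro sorted_wrt_mono_rel[OF _ sorted_wrt_upt]) (simp add: divide_strict_right_mono)
  moreover have "hd p = 0" by (simp add: p_def upt_rec)
  moreover have "last p = t" using \<open>N > 0\<close> by (simp add: p_def)
  moreover have "p \<noteq> []" by (simp add: p_def)
  ultimately have "p \<in> partitions t" by (simp add: partitions_def)
  moreover have "p ! Suc i - p ! i < h" if "Suc i < length p" for i
  proof -
    have nth: "p ! j = t * real j / real N" if "j < Suc N" for j
      using that unfolding p_def by (subst nth_map) (auto simp del: upt_Suc)
    have "p ! Suc i - p ! i = t / real N"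
      using that by (subst (1 2) nth) (auto simp: p_def field_simps)
    also have "\<dots> < h" using N assms \<open>N > 0\<close> by (simp add: field_simps)
    finally show ?thesis .
  qed
  ultimately show ?thesis using that by blast
qed

text \<open>For a fine partition every jump time of \<open>J\<close> lies in its own partition interval. The
  increments over these intervals converge to the jumps, and the remaining squares are
  nonnegative.\<close>

lemma sum_jump_sq_le_lim_sum_sq_incr:
  assumes f: "cadlag_on t f" and J: "finite J" "J \<subseteq> {0..t}"
    and part: "\<And>m. p m \<in> partitions t"
    and mesh: "\<And>m i. Suc i < length (p m) \<Longrightarrow> p m ! Suc i - p m ! i < h m" "h \<longlonglongrightarrow> 0"
    and lim: "(\<lambda>m. sum_sq_incr f (p m)) \<longlonglongrightarrow> Q"
  shows "(\<Sum>s\<in>J. (jump f s)\<^sup>2) \<le> Q"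
proof -
  \<comment> \<open>No partition interval \<open>(u\<^sub>i, u\<^sub>i\<^sub>+\<^sub>1]\<close> contains \<open>0\<close>, where the jump vanishes by convention.\<close>
  define K where "K = J - {0}"
  have K: "finite K" "K \<subseteq> {0<..t}" using J by (auto simp: K_def)
  have "\<forall>m s. \<exists>i. s \<in> K \<longrightarrow> Suc i < length (p m) \<and> p m ! i < s \<and> s \<le> p m ! Suc i"
    using partition_bracket[OF part] K by (metis greaterThanAtMost_iff subsetD)
  then obtain i where i: "\<And>m s. s \<in> K \<Longrightarrow> Suc (i m s) < length (p m)"
      "\<And>m s. s \<in> K \<Longrightarrow> p m ! i m s < s" "\<And>m s. s \<in> K \<Longrightarrow> s \<le> p m ! Suc (i m s)"
    by metis
  have incr: "(\<lambda>m. f (p m ! Suc (i m s)) - f (p m ! i m s)) \<longlonglongrightarrow> jump f s" if "s \<in> K" for s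
  proof (rule cadlag_on_increment_tendsto_jump[OF f])
    show "s \<in> {0<..t}" using that K by blast
    show "p m ! i m s \<in> {0..<s}" "p m ! Suc (i m s) \<in> {s..t}" for m
      using partition_nth_mem[OF part[of m]] i[OF that, of m] by (auto simp: Suc_lessD)
    have near: "s - h m \<le> p m ! i m s" "p m ! Suc (i m s) \<le> s + h m" for m
      using mesh(1)[OF i(1)[OF that, of m]] i(2,3)[OF that, of m] by linarith+
    have l: "(\<lambda>m. s - h m) \<longlonglongrightarrow> s" "(\<lambda>m. s + h m) \<longlonglongrightarrow> s"
      using tendsto_diff[OF tendsto_const[of s] mesh(2)] tendsto_add[OF tendsto_const[of s] mesh(2)]
      by simp_all
    show "(\<lambda>m. p m ! i m s) \<longlonglongrightarrow> s"
      by (rule tendsto_sandwich[OF _ _ l(1) tendsto_const[of s]])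
        (use near i(2)[OF that] in \<open>auto intro!: always_eventually less_imp_le\<close>)
    show "(\<lambda>m. p m ! Suc (i m s)) \<longlonglongrightarrow> s"
      by (rule tendsto_sandwich[OF _ _ tendsto_const[of s] l(2)])
        (use near i(3)[OF that] in \<open>auto intro!: always_eventually\<close>)
  qed
  have "(\<lambda>m. \<Sum>s\<in>K. (f (p m ! Suc (i m s)) - f (p m ! i m s))\<^sup>2) \<longlonglongrightarrow> (\<Sum>s\<in>K. (jump f s)\<^sup>2)"
    by (intro tendsto_sum tendsto_power incr)
  moreover have "eventually (\<lambda>m. (\<Sum>s\<in>K. (f (p m ! Suc (i m s)) - f (p m ! i m s))\<^sup>2)
      \<le> sum_sq_incr f (p m)) sequentially"
  proof -
    have "eventually (\<lambda>m. \<forall>s\<in>K. \<forall>s'\<in>K. s \<noteq> s' \<longrightarrow> h m < \<bar>s - s'\<bar>) sequentially"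
    proof (intro eventually_ball_finite[OF K(1)] ballI)
      fix s s' assume "s \<in> K" "s' \<in> K"
      show "eventually (\<lambda>m. s \<noteq> s' \<longrightarrow> h m < \<bar>s - s'\<bar>) sequentially"
      proof (cases "s = s'")
        case False
        thus ?thesis using order_tendstoD(2)[OF mesh(2), of "\<bar>s - s'\<bar>"]
          by (auto elim: eventually_mono)
      qed simp
    qed
    thus ?thesis
    proof eventually_elim
      case (elim m)
      have inj: "inj_on (i m) K"
      proof (rule inj_onI, rule ccontr)
        fix s s' assume s: "s \<in> K" "s' \<in> K" "i m s = i m s'" "s \<noteq> s'"
        have "\<bar>s - s'\<bar> < h m"
          using mesh(1)[OF i(1)[OF s(1), of m]] i(2,3)[OF s(1), of m] i(2,3)[OF s(2), of m] s(3)
          by simp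
        thus False using elim s by force
      qed
      have "(\<Sum>s\<in>K. (f (p m ! Suc (i m s)) - f (p m ! i m s))\<^sup>2)
          = (\<Sum>j\<in>i m ` K. (f (p m ! Suc j) - f (p m ! j))\<^sup>2)"
        by (simp add: sum.reindex[OF inj])
      also have "\<dots> \<le> (\<Sum>j<length (p m) - 1. (f (p m ! Suc j) - f (p m ! j))\<^sup>2)"
        using i(1)[of _ m] by (intro sum_mono2) force+
      finally show ?case by (simp add: sum_sq_incr_def)
    qed
  qed
  ultimately have "(\<Sum>s\<in>K. (jump f s)\<^sup>2) \<le> Q"
    using lim by (intro tendsto_le[OF _ lim]) auto
  moreover have "(\<Sum>s\<in>K. (jump f s)\<^sup>2) = (\<Sum>s\<in>J. (jump f s)\<^sup>2)"
    using J unfolding K_def by (intro sum.mono_neutral_left) auto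
  ultimately show ?thesis by simp
qed

text \<open>Convergence in probability along the mesh filter is upgraded, by Borel--Cantelli, to almost
  sure convergence along a suitable sequence of partitions; the pathwise bound applies to that
  sequence, simultaneously for all finite sets of times.\<close>

lemma (in prob_space) AE_sum_jump_sq_le_quadratic_variation:
  assumes "t > 0"
    and meas: "\<And>u. u \<in> {0..t} \<Longrightarrow> Y u \<in> borel_measurable M"
    and cad: "\<And>\<omega>. \<omega> \<in> space M \<Longrightarrow> cadlag_on t (\<lambda>s. Y s \<omega>)"
    and qv: "has_quadratic_variation M t Y Q"
  shows "AE \<omega> in M. \<forall>J. finite J \<and> J \<subseteq> {0..t} \<longrightarrow> (\<Sum>s\<in>J. (jump (\<lambda>u. Y u \<omega>) s)\<^sup>2) \<le> Q t \<omega>"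
proof -
  define S where "S p \<omega> = sum_sq_incr (\<lambda>s. Y s \<omega>) p" for p \<omega>
  define bad where "bad p m = {\<omega> \<in> space M. \<bar>S p \<omega> - Q t \<omega>\<bar> > (1/2) ^ m}" for p and m :: nat
  have Q [measurable]: "Q t \<in> borel_measurable M" and
    conv: "tendsto_in_prob M S (Q t) (mesh_to_0 t)"
    using qv \<open>t > 0\<close> unfolding has_quadratic_variation_def S_def by auto
  have "\<exists>p \<in> partitions t. (\<forall>i. Suc i < length p \<longrightarrow> p ! Suc i - p ! i < inverse (real (Suc m))) \<and>
      prob (bad p m) < (1/2) ^ m" for m
  proof -
    have "((\<lambda>p. prob (bad p m)) \<longlongrightarrow> 0) (mesh_to_0 t)"
      using conv unfolding tendsto_in_prob_def bad_def by simp
    hence "eventually (\<lambda>p. prob (bad p m) < (1/2) ^ m) (mesh_to_0 t)"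
      by (intro order_tendstoD(2)) auto
    moreover have "eventually P (mesh_to_0 t) \<longleftrightarrow> (\<exists>h\<in>{0<..}. eventually P
        (principal {p \<in> partitions t. \<forall>i. Suc i < length p \<longrightarrow> p ! Suc i - p ! i < h}))" for P
      unfolding mesh_to_0_def
    proof (rule eventually_INF_base)
      fix a b :: real assume "a \<in> {0<..}" "b \<in> {0<..}"
      thus "\<exists>x\<in>{0<..}. principal {p \<in> partitions t. \<forall>i. Suc i < length p \<longrightarrow> p ! Suc i - p ! i < x}
          \<le> principal {p \<in> partitions t. \<forall>i. Suc i < length p \<longrightarrow> p ! Suc i - p ! i < a} \<sqinter>
            principal {p \<in> partitions t. \<forall>i. Suc i < length p \<longrightarrow> p ! Suc i - p ! i < b}"
        by (intro bexI[of _ "min a b"]) auto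
    qed auto
    ultimately obtain h where h: "h > 0"
      "\<And>p. p \<in> partitions t \<Longrightarrow> (\<forall>i. Suc i < length p \<longrightarrow> p ! Suc i - p ! i < h) \<Longrightarrow> prob (bad p m) < (1/2) ^ m"
      by (auto simp: eventually_principal)
    obtain p where p: "p \<in> partitions t"
      "\<And>i. Suc i < length p \<Longrightarrow> p ! Suc i - p ! i < min h (inverse (real (Suc m)))"
      using partition_of_small_mesh[OF \<open>t > 0\<close>, of "min h (inverse (real (Suc m)))"] h by auto
    thus ?thesis using h(2)[OF p(1)] by (intro bexI[of _ p]) auto
  qed
  then obtain p where p: "\<And>m. p m \<in> partitions t"
    "\<And>m i. Suc i < length (p m) \<Longrightarrow> p m ! Suc i - p m ! i < inverse (real (Suc m))"
    "\<And>m. prob (bad (p m) m) < (1/2) ^ m"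
    by metis
  have [measurable]: "S (p m) \<in> borel_measurable M" for m
    unfolding S_def sum_sq_incr_def
    by (intro borel_measurable_sum borel_measurable_power borel_measurable_diff meas
        partition_nth_mem[OF p(1)]) auto
  have sets: "bad (p m) m \<in> sets M" for m unfolding bad_def by measurable
  have "summable (\<lambda>m. prob (bad (p m) m))"
    using p(3) by (intro summable_comparison_test'[OF summable_geometric[of "1/2 :: real"], of 0])
      (auto intro: less_imp_le)
  hence "AE \<omega> in M. eventually (\<lambda>m. \<omega> \<in> space M - bad (p m) m) sequentially"
    using sets by (intro borel_cantelli_AE1) (auto simp: emeasure_eq_measure)
  thus ?thesis
  proof (eventually_elim, safe)
    fix \<omega> J
    assume ev: "eventually (\<lambda>m. \<omega> \<in> space M - bad (p m) m) sequentially"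
      and J: "finite J" "J \<subseteq> {0..t}"
    have \<omega>: "\<omega> \<in> space M" using ev eventually_happens'[OF sequentially_bot ev] by auto
    have "eventually (\<lambda>m. norm (S (p m) \<omega> - Q t \<omega>) \<le> (1/2) ^ m) sequentially"
      using ev by eventually_elim (auto simp: bad_def)
    hence "(\<lambda>m. S (p m) \<omega> - Q t \<omega>) \<longlonglongrightarrow> 0"
      by (rule Lim_null_comparison) (intro LIMSEQ_power_zero, simp)
    hence "(\<lambda>m. S (p m) \<omega>) \<longlonglongrightarrow> Q t \<omega>" by (simp add: LIM_zero_iff)
    thus "(\<Sum>s\<in>J. (jump (\<lambda>u. Y u \<omega>) s)\<^sup>2) \<le> Q t \<omega>"
      unfolding S_def
      by (intro sum_jump_sq_le_lim_sum_sq_incr[OF cad[OF \<omega>] J p(1,2) LIMSEQ_inverse_real_of_nat])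
  qed
qed

text \<open>Pointwise \<open>(\<Delta>g)\<^sup>2 \<le> 2 (\<Delta>(g - f))\<^sup>2 + 2 (\<Delta>f)\<^sup>2\<close>, and a small jump of \<open>g\<close> occurs only at a small
  jump of \<open>f\<close>. An unordered sum in \<open>ennreal\<close> is the supremum of its finite partial sums, so a bound
  on finite sums of squared jumps of \<open>g - f\<close> is enough.\<close>

lemma small_jump_sum_le:
  assumes fg: "cadlag_on t f" "cadlag_on t g"
    and bound: "\<And>J. finite J \<Longrightarrow> J \<subseteq> {0..t} \<Longrightarrow> (\<Sum>s\<in>J. (jump (\<lambda>u. g u - f u) s)\<^sup>2) \<le> q"
    and small: "\<And>s. s \<in> {0..t} \<Longrightarrow> \<bar>jump g s\<bar> \<le> c \<Longrightarrow> \<bar>jump f s\<bar> \<le> c"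
  shows "small_jump_sum t c g \<le> 2 * ennreal q + 2 * small_jump_sum t c f"
proof -
  define a where "a h s = (jump h s)\<^sup>2 * of_bool (\<bar>jump h s\<bar> \<le> c)" for h s
  have a0: "a h s \<ge> 0" for h s by (simp add: a_def)
  have "(\<Sum>s\<in>J. ennreal (a g s)) \<le> 2 * ennreal q + 2 * small_jump_sum t c f"
    if J: "finite J" "J \<subseteq> {0..t}" for J
  proof -
    let ?d = "\<lambda>s. (jump (\<lambda>u. g u - f u) s)\<^sup>2"
    have "a g s \<le> 2 * ?d s + 2 * a f s" if "s \<in> J" for s
    proof (cases "\<bar>jump g s\<bar> \<le> c")
      case True
      have s: "s \<in> {0..t}" using that J by auto
      have "(jump g s)\<^sup>2 \<le> 2 * (jump g s - jump f s)\<^sup>2 + 2 * (jump f s)\<^sup>2"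
        using zero_le_power2[of "jump g s - 2 * jump f s"] by (simp add: power2_eq_square algebra_simps)
      thus ?thesis using True small[OF s True] jump_diff[OF fg(2,1) s] by (simp add: a_def)
    next
      case False
      thus ?thesis using a0[of f s] by (simp add: a_def[of g])
    qed
    hence "(\<Sum>s\<in>J. ennreal (a g s)) \<le> (\<Sum>s\<in>J. ennreal (2 * ?d s + 2 * a f s))"
      by (intro sum_mono ennreal_leI)
    also have "\<dots> = ennreal (2 * (\<Sum>s\<in>J. ?d s) + 2 * (\<Sum>s\<in>J. a f s))"
      using a0 by (subst sum_ennreal) (auto simp: sum.distrib sum_distrib_left)
    also have "\<dots> = 2 * ennreal (\<Sum>s\<in>J. ?d s) + 2 * (\<Sum>s\<in>J. ennreal (a f s))"
      using a0 by (simp add: ennreal_mult sum_nonneg)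
    also have "\<dots> \<le> 2 * ennreal q + 2 * small_jump_sum t c f"
    proof (intro add_mono mult_left_mono)
      show "ennreal (\<Sum>s\<in>J. ?d s) \<le> ennreal q" using J by (intro ennreal_leI bound)
      show "(\<Sum>s\<in>J. ennreal (a f s)) \<le> small_jump_sum t c f"
        unfolding small_jump_sum_def a_def[symmetric]
        using J by (subst nonneg_infsum_complete) (auto intro: SUP_upper)
    qed auto
    finally show ?thesis .
  qed
  thus ?thesis
    unfolding small_jump_sum_def[of t c g] a_def[symmetric]
    by (subst nonneg_infsum_complete) (auto intro: SUP_least)
qed

section \<open>The random threshold\<close>

text \<open>The excluded bands, listed by \<open>k\<close>, are consecutive intervals increasing to \<open>r\<close>.\<close>

lemma jump_level_minus_radius: "jump_level r k - jump_radius k r = r * (1 - 1 / 2 ^ k)"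
  by (simp add: jump_level_def jump_radius_def field_simps)

lemma jump_level_plus_radius: "jump_level r k + jump_radius k r = r * (1 - 1 / 2 ^ Suc k)"
  by (simp add: jump_level_def jump_radius_def field_simps)

text \<open>Neighbouring bands share an end point, so one jump can serve two of them. The bands of odd index
  are pairwise disjoint; if each contained a jump size, there would be infinitely many jumps of size
  at least \<open>r / 2\<close>.\<close>

lemma cadlag_on_avoids_some_band:
  assumes f: "cadlag_on t f" and "r > 0"
  shows "\<exists>k\<ge>1. \<forall>s\<in>{0..t}. \<bar>\<bar>jump f s\<bar> - jump_level r k\<bar> > jump_radius k r"
proof (rule ccontr)
  assume "\<not> ?thesis"
  hence "\<exists>s\<in>{0..t}. \<bar>\<bar>jump f s\<bar> - jump_level r k\<bar> \<le> jump_radius k r" if "k \<ge> 1" for k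
    using that by (meson not_le)
  hence "\<exists>s\<in>{0..t}. \<bar>\<bar>jump f s\<bar> - jump_level r (2 * k + 1)\<bar> \<le> jump_radius (2 * k + 1) r" for k
    by simp
  then obtain s where s: "\<And>k. s k \<in> {0..t}"
    "\<And>k. \<bar>\<bar>jump f (s k)\<bar> - jump_level r (2 * k + 1)\<bar> \<le> jump_radius (2 * k + 1) r"
    by metis
  have band: "r * (1 - 1 / 2 ^ (2 * k + 1)) \<le> \<bar>jump f (s k)\<bar>"
    "\<bar>jump f (s k)\<bar> \<le> r * (1 - 1 / 2 ^ (2 * k + 2))" for k
    using s(2)[of k] jump_level_minus_radius[of r "2 * k + 1"] jump_level_plus_radius[of r "2 * k + 1"]
    by (simp_all add: abs_le_iff) linarith+
  have less: "\<bar>jump f (s j)\<bar> < \<bar>jump f (s k)\<bar>" if "j < k" for j k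
  proof -
    have "(2::real) ^ (2 * j + 2) < 2 ^ (2 * k + 1)"
      using that by (intro power_strict_increasing) auto
    hence "(1::real) / 2 ^ (2 * k + 1) < 1 / 2 ^ (2 * j + 2)"
      by (intro divide_strict_left_mono) auto
    hence "r * (1 - 1 / 2 ^ (2 * j + 2)) < r * (1 - 1 / 2 ^ (2 * k + 1))"
      using \<open>r > 0\<close> by (intro mult_strict_left_mono) auto
    thus ?thesis using band(2)[of j] band(1)[of k] by linarith
  qed
  have "inj s"
    using less by (metis injI less_irrefl linorder_neqE_nat)
  hence "infinite (range s)" using finite_imageD by blast
  moreover have "r / 2 \<le> \<bar>jump f (s k)\<bar>" for k
  proof -
    have "(1::real) / 2 ^ (2 * k + 1) \<le> 1 / 2" by (simp add: field_simps)
    hence "r * (1 / 2) \<le> r * (1 - 1 / 2 ^ (2 * k + 1))"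
      using \<open>r > 0\<close> by (intro mult_left_mono) auto
    thus ?thesis using band(1)[of k] by simp
  qed
  hence "range s \<subseteq> {u \<in> {0..t}. r / 2 \<le> \<bar>jump f u\<bar>}" using s(1) by auto
  ultimately show False
    using finite_large_jumps[OF f, of "r / 2"] \<open>r > 0\<close> finite_subset by auto
qed

theorem lemma5p1:
  fixes M :: "'a measure" and F :: "real \<Rightarrow> 'a measure"
    and t r :: real
    and X :: "real \<Rightarrow> 'a \<Rightarrow> real"
    and Xn :: "nat \<Rightarrow> real \<Rightarrow> 'a \<Rightarrow> real"
    and QV :: "nat \<Rightarrow> real \<Rightarrow> 'a \<Rightarrow> real"
  assumes "usual_filtered_prob_space M F"
    and "t > 0"
    and "adapted_cadlag M F t X"
    and "\<And>n. n \<ge> 1 \<Longrightarrow> adapted_cadlag M F t (Xn n)"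
    and "\<And>n. n \<ge> 1 \<Longrightarrow> has_quadratic_variation M t (\<lambda>s \<omega>. Xn n s \<omega> - X s \<omega>) (QV n)"
    and "tendsto_in_prob M (\<lambda>n. QV n t) (\<lambda>_. 0) sequentially"
    and "r > 0"
  defines "L \<equiv> jump_level r"
    and "\<delta> \<equiv> (\<lambda>k. jump_radius k r)"
    and "A \<equiv> (\<lambda>k. event_A M t X k r)"
    and "B \<equiv> (\<lambda>n k. event_B M t (\<lambda>s \<omega>. Xn n s \<omega> - X s \<omega>) k r)"
    and "\<Delta>X \<equiv> (\<lambda>\<omega>. jump (\<lambda>s. X s \<omega>))"
    and "\<Delta>Xn \<equiv> (\<lambda>n \<omega>. jump (\<lambda>s. Xn n s \<omega>))"
  shows
    "(\<forall>k\<ge>1. A k \<in> sets M) \<and>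
     measure M (\<Union>k\<in>{1..}. A k) = 1 \<and>
     (\<forall>k\<ge>1.
        (\<forall>n\<ge>1. B n k \<in> sets M) \<and>
        (\<lambda>n. measure M (B n k)) \<longlonglongrightarrow> 1 \<and>
        (\<forall>n\<ge>1.
           (\<forall>\<omega> \<in> A k \<inter> B n k. \<forall>s\<in>{0..t}.
              (\<bar>\<Delta>X \<omega> s\<bar> \<le> L k - \<delta> k \<longrightarrow> \<bar>\<Delta>Xn n \<omega> s\<bar> < L k) \<and>
              (\<bar>\<Delta>X \<omega> s\<bar> \<ge> L k + \<delta> k \<longrightarrow> \<bar>\<Delta>Xn n \<omega> s\<bar> > L k) \<and>
              (of_bool (\<bar>\<Delta>Xn n \<omega> s\<bar> \<le> L k) :: real) \<le> of_bool (\<bar>\<Delta>X \<omega> s\<bar> \<le> L k)) \<and>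
           (AE \<omega> in M. \<omega> \<in> A k \<inter> B n k \<longrightarrow>
              small_jump_sum t (L k) (\<lambda>s. Xn n s \<omega>)
                \<le> 2 * ennreal (QV n t \<omega>) + 2 * small_jump_sum t (L k) (\<lambda>s. X s \<omega>))))"
proof -
  interpret usual_filtered_prob_space M F by fact
  define Y where "Y n s \<omega> = Xn n s \<omega> - X s \<omega>" for n s \<omega>
  have meas: "Z u \<in> borel_measurable M" if "adapted_cadlag M F t Z" "u \<in> {0..t}" for Z u
    using that subalgebra_F[of u] unfolding adapted_cadlag_def
    by (auto intro: measurable_from_subalg)
  have cad: "cadlag_on t (\<lambda>s. Z s \<omega>)" if "adapted_cadlag M F t Z" "\<omega> \<in> space M" for Z \<omega>
    using that unfolding adapted_cadlag_def by auto
  note X_cad = cad[OF \<open>adapted_cadlag M F t X\<close>]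
  have Xn_cad: "cadlag_on t (\<lambda>s. Xn n s \<omega>)" if "n \<ge> 1" "\<omega> \<in> space M" for n \<omega>
    using that assms(4) cad by blast
  have Y_cad: "cadlag_on t (\<lambda>s. Y n s \<omega>)" if "n \<ge> 1" "\<omega> \<in> space M" for n \<omega>
    unfolding Y_def using that by (intro cadlag_on_diff Xn_cad X_cad)
  have Y_meas: "Y n u \<in> borel_measurable M" if "n \<ge> 1" "u \<in> {0..t}" for n u
    unfolding Y_def using that assms(3,4) by (intro borel_measurable_diff meas) auto
  have \<Delta>Y: "jump (\<lambda>s. Y n s \<omega>) s = \<Delta>Xn n \<omega> s - \<Delta>X \<omega> s"
    if "n \<ge> 1" "\<omega> \<in> space M" "s \<in> {0..t}" for n \<omega> s
    unfolding Y_def \<Delta>X_def \<Delta>Xn_def using jump_diff[OF Xn_cad X_cad] that by blast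
  have \<delta>0: "\<delta> k > 0" for k using \<open>r > 0\<close> by (simp add: \<delta>_def jump_radius_def)
  have L\<delta>: "L k - \<delta> k > 0" if "k \<ge> 1" for k
    using that \<open>r > 0\<close> by (simp add: L_def \<delta>_def jump_level_minus_radius)
  have A_iff: "\<omega> \<in> A k \<longleftrightarrow> \<omega> \<in> space M \<and> (\<forall>s\<in>{0..t}. \<bar>\<bar>\<Delta>X \<omega> s\<bar> - L k\<bar> > \<delta> k)" for k \<omega>
    by (simp add: A_def event_A_def \<Delta>X_def L_def \<delta>_def)
  have B_iff: "\<omega> \<in> B n k \<longleftrightarrow> \<omega> \<in> space M \<and> (\<forall>s\<in>{0..t}. \<bar>jump (\<lambda>s. Y n s \<omega>) s\<bar> < \<delta> k)"
    if "n \<ge> 1" for n k \<omega>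
    using Sup_jump_less_iff[OF Y_cad[OF that], of \<omega> "\<delta> k"] \<delta>0[of k] \<open>t > 0\<close>
    by (auto simp: B_def event_B_def \<delta>_def Y_def)

  have A_sets: "A k \<in> sets M" if "k \<ge> 1" for k
  proof -
    define C where "C = {x :: real. \<bar>\<bar>x\<bar> - L k\<bar> \<le> \<delta> k}"
    have "closed C" unfolding C_def by (intro closed_Collect_le continuous_intros)
    moreover have "0 \<notin> C" using L\<delta>[OF that] by (simp add: C_def)
    ultimately have "{\<omega> \<in> space M. \<exists>s\<in>{0..t}. jump (\<lambda>u. X u \<omega>) s \<in> C} \<in> sets M"
      using assms(2,3) by (intro sets_ex_jump_in_closed meas X_cad) auto
    moreover have "A k = space M - {\<omega> \<in> space M. \<exists>s\<in>{0..t}. jump (\<lambda>u. X u \<omega>) s \<in> C}"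
      unfolding set_eq_iff Diff_iff mem_Collect_eq A_iff C_def \<Delta>X_def not_less[symmetric] by blast
    ultimately show ?thesis by simp
  qed

  have "(\<Union>k\<in>{1..}. A k) = space M"
  proof (intro equalityI UN_least subsetI)
    fix \<omega> assume \<omega>: "\<omega> \<in> space M"
    obtain k where "k \<ge> 1" "\<forall>s\<in>{0..t}. \<bar>\<bar>\<Delta>X \<omega> s\<bar> - L k\<bar> > \<delta> k"
      using cadlag_on_avoids_some_band[OF X_cad[OF \<omega>] \<open>r > 0\<close>]
      unfolding \<Delta>X_def L_def \<delta>_def by blast
    with \<omega> show "\<omega> \<in> (\<Union>k\<in>{1..}. A k)" by (intro UN_I[of k]) (simp_all add: A_iff)
  next
    fix k \<omega> assume "\<omega> \<in> A k"
    thus "\<omega> \<in> space M" by (simp add: A_iff)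
  qed
  hence A_union: "measure M (\<Union>k\<in>{1..}. A k) = 1" by (simp add: prob_space)

  have B_sets: "B n k \<in> sets M" if "n \<ge> 1" for n k
  proof -
    define C where "C = {x :: real. \<delta> k \<le> \<bar>x\<bar>}"
    have "closed C" unfolding C_def by (intro closed_Collect_le continuous_intros)
    moreover have "0 \<notin> C" using \<delta>0[of k] by (simp add: C_def)
    ultimately have "{\<omega> \<in> space M. \<exists>s\<in>{0..t}. jump (\<lambda>u. Y n u \<omega>) s \<in> C} \<in> sets M"
      using that \<open>t > 0\<close> by (intro sets_ex_jump_in_closed Y_meas Y_cad) auto
    moreover have "B n k = space M - {\<omega> \<in> space M. \<exists>s\<in>{0..t}. jump (\<lambda>u. Y n u \<omega>) s \<in> C}"
      unfolding set_eq_iff Diff_iff mem_Collect_eq B_iff[OF that] C_def not_less[symmetric] by blast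
    ultimately show ?thesis by simp
  qed

  have jumps_QV: "AE \<omega> in M. \<forall>J. finite J \<and> J \<subseteq> {0..t} \<longrightarrow>
      (\<Sum>s\<in>J. (jump (\<lambda>u. Y n u \<omega>) s)\<^sup>2) \<le> QV n t \<omega>" if "n \<ge> 1" for n
    using that assms(5)[OF that] \<open>t > 0\<close>
    by (intro AE_sum_jump_sq_le_quadratic_variation Y_meas Y_cad) (auto simp: Y_def[abs_def])

  have B_lim: "(\<lambda>n. measure M (B n k)) \<longlonglongrightarrow> 1" for k
  proof -
    \<comment> \<open>Off \<open>B n k\<close> some jump has square at least \<open>(\<delta> k)\<^sup>2\<close>; halving makes the bound strict, as
      convergence in probability requires.\<close>
    define c where "c = (\<delta> k)\<^sup>2 / 2"
    have "c > 0" using \<delta>0[of k] by (simp add: c_def)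
    define E where "E n = {\<omega> \<in> space M. \<bar>QV n t \<omega> - 0\<bar> > c}" for n
    have "(\<lambda>n. measure M (E n)) \<longlonglongrightarrow> 0"
      using assms(6) \<open>c > 0\<close> unfolding tendsto_in_prob_def E_def by blast
    hence lim: "(\<lambda>n. 1 - measure M (E n)) \<longlonglongrightarrow> 1"
      using tendsto_diff[OF tendsto_const[of 1]] by fastforce
    have bound: "1 - measure M (E n) \<le> measure M (B n k)" if n: "n \<ge> 1" for n
    proof -
      have "QV n t \<in> borel_measurable M"
        using assms(5)[OF n] \<open>t > 0\<close> by (auto simp: has_quadratic_variation_def)
      hence E_sets: "E n \<in> sets M" unfolding E_def by measurable
      have "AE \<omega> in M. \<omega> \<in> space M - E n \<longrightarrow> \<omega> \<in> B n k"
        using jumps_QV[OF n]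
      proof (eventually_elim, intro impI)
        fix \<omega> assume le: "\<forall>J. finite J \<and> J \<subseteq> {0..t} \<longrightarrow>
            (\<Sum>s\<in>J. (jump (\<lambda>u. Y n u \<omega>) s)\<^sup>2) \<le> QV n t \<omega>"
          and \<omega>: "\<omega> \<in> space M - E n"
        have "\<bar>jump (\<lambda>u. Y n u \<omega>) s\<bar> < \<delta> k" if "s \<in> {0..t}" for s
        proof -
          have "(jump (\<lambda>u. Y n u \<omega>) s)\<^sup>2 \<le> QV n t \<omega>" using le[rule_format, of "{s}"] that by simp
          also have "\<dots> \<le> c" using \<omega> by (auto simp: E_def)
          also have "c < (\<delta> k)\<^sup>2" using \<delta>0[of k] by (simp add: c_def)
          finally show ?thesis
            using power2_less_imp_less[of "\<bar>jump (\<lambda>u. Y n u \<omega>) s\<bar>" "\<delta> k"] \<delta>0[of k] by simp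
        qed
        thus "\<omega> \<in> B n k" using \<omega> by (simp add: B_iff[OF n])
      qed
      hence "measure M (space M - E n) \<le> measure M (B n k)"
        using B_sets[OF n] by (intro finite_measure_mono_AE) auto
      thus ?thesis using prob_compl[OF E_sets] by simp
    qed
    show ?thesis
      by (rule tendsto_sandwich[OF _ _ lim tendsto_const])
        (use bound in \<open>auto intro!: eventually_sequentiallyI[of 1]\<close>)
  qed

  have keep: "(\<bar>\<Delta>X \<omega> s\<bar> \<le> L k - \<delta> k \<longrightarrow> \<bar>\<Delta>Xn n \<omega> s\<bar> < L k) \<and>
      (\<bar>\<Delta>X \<omega> s\<bar> \<ge> L k + \<delta> k \<longrightarrow> \<bar>\<Delta>Xn n \<omega> s\<bar> > L k) \<and>
      (\<bar>\<Delta>Xn n \<omega> s\<bar> \<le> L k \<longrightarrow> \<bar>\<Delta>X \<omega> s\<bar> \<le> L k)"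
    if "n \<ge> 1" "\<omega> \<in> A k \<inter> B n k" "s \<in> {0..t}" for n k \<omega> s
  proof -
    have "\<omega> \<in> space M" using that by (simp add: A_iff)
    moreover have "\<bar>jump (\<lambda>s. Y n s \<omega>) s\<bar> < \<delta> k"
      using that(2,3) unfolding Int_iff B_iff[OF that(1)] by blast
    ultimately have "\<bar>\<Delta>Xn n \<omega> s - \<Delta>X \<omega> s\<bar> < \<delta> k"
      using \<Delta>Y[OF that(1) _ that(3)] by simp
    moreover have "\<bar>\<bar>\<Delta>X \<omega> s\<bar> - L k\<bar> > \<delta> k"
      using that(2,3) unfolding Int_iff A_iff by blast
    ultimately show ?thesis by linarith
  qed

  have sums: "AE \<omega> in M. \<omega> \<in> A k \<inter> B n k \<longrightarrow> small_jump_sum t (L k) (\<lambda>s. Xn n s \<omega>)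
      \<le> 2 * ennreal (QV n t \<omega>) + 2 * small_jump_sum t (L k) (\<lambda>s. X s \<omega>)" if n: "n \<ge> 1" for n k
    using jumps_QV[OF n]
  proof (eventually_elim, intro impI)
    fix \<omega> assume le: "\<forall>J. finite J \<and> J \<subseteq> {0..t} \<longrightarrow>
        (\<Sum>s\<in>J. (jump (\<lambda>u. Y n u \<omega>) s)\<^sup>2) \<le> QV n t \<omega>"
      and \<omega>: "\<omega> \<in> A k \<inter> B n k"
    have "\<omega> \<in> space M" using \<omega> by (simp add: A_iff)
    thus "small_jump_sum t (L k) (\<lambda>s. Xn n s \<omega>)
        \<le> 2 * ennreal (QV n t \<omega>) + 2 * small_jump_sum t (L k) (\<lambda>s. X s \<omega>)"
      using le keep[OF n \<omega>] n unfolding Y_def \<Delta>X_def \<Delta>Xn_def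
      by (intro small_jump_sum_le X_cad Xn_cad) blast+
  qed

  have of_bool_mono: "(of_bool P :: real) \<le> of_bool Q" if "P \<longrightarrow> Q" for P Q
    using that by simp
  show ?thesis
  proof (intro conjI allI impI ballI)
    fix n k :: nat and \<omega> s
    assume "1 \<le> n" "\<omega> \<in> A k \<inter> B n k" "s \<in> {0..t}"
    note kp = keep[OF this]
    show "\<bar>\<Delta>Xn n \<omega> s\<bar> < L k" if "\<bar>\<Delta>X \<omega> s\<bar> \<le> L k - \<delta> k" using kp that by blast
    show "\<bar>\<Delta>Xn n \<omega> s\<bar> > L k" if "\<bar>\<Delta>X \<omega> s\<bar> \<ge> L k + \<delta> k" using kp that by blast
    show "(of_bool (\<bar>\<Delta>Xn n \<omega> s\<bar> \<le> L k) :: real) \<le> of_bool (\<bar>\<Delta>X \<omega> s\<bar> \<le> L k)"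
      using kp by (intro of_bool_mono) blast
  qed (rule A_union B_lim | erule A_sets B_sets sums)+
qed

end
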